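(* Let $\mathbf{x}$ be a random vector in $\mathbb{R}^d$ (the real state), let $\mathcal{I}=\{1,\dots,I\}$, and let $\hat{\mathbf{x}}_i$, $i\in\mathcal{I}$, be estimators of $\mathbf{x}$ that are conditionally independent and unbiased. Let $w_i\ge 0$, $i\in\mathcal{I}$, with $\sum_{i\in\mathcal{I}}w_i=1$, and let $\hat{\mathbf{x}}_{\mathrm{AA}}=\sum_{i\in\mathcal{I}}w_i\hat{\mathbf{x}}_i$ be the arithmetic average (AA) fusion. Then $$\sum_{i\in\mathcal{I}} w_i\big(\mathrm{MSE}_{\hat{\mathbf{x}}_i}-\mathrm{MSE}_{\hat{\mathbf{x}}_{\mathrm{AA}}}\big)\succ \mathbf{0}.$$
   Context: Each estimator $\hat{\mathbf{x}}_i$ is a function of the random observations of sensor $i$. "Conditionally independent and unbiased" means that, given $\mathbf{x}$, the observations of different sensors (hence the estimators $\hat{\mathbf{x}}_i$) are independent of each other, and $\mathrm{E}[\hat{\mathbf{x}}_i\mid\mathbf{x}]=\mathbf{x}$ for each $i$. In particular the mean-cross-errors $\mathrm{MCE}(\hat{\mathbf{x}}_i,\hat{\mathbf{x}}_j)=\mathrm{E}[(\mathbf{x}-\hat{\mathbf{x}}_i)(\mathbf{x}-\hat{\mathbf{x}}_j)^{\mathrm{T}}]$ vanish for all $i\neq j$. The mean square error matrix of an estimator $\hat{\mathbf{x}}$ is $\mathrm{MSE}_{\hat{\mathbf{x}}}=\mathrm{E}[(\mathbf{x}-\hat{\mathbf{x}})(\mathbf{x}-\hat{\mathbf{x}})^{\mathrm{T}}]$,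 the expectation being over the joint law of the state and the observations and all second moments being finite. The symbol $\succ\mathbf{0}$ means positive definite.
   Formalization: Added hypothesis: no weight equals 1, and for each nonzero v some sensor with positive weight has v·(x − x̂_i) not a.s. zero. Otherwise the matrix is not positive definite (e.g. I = 1, or x̂_i = x for all i, gives the zero matrix). *)

theory Defs
  imports "HOL-Probability.Probability"
begin

definition sigma_rv :: "'w measure \<Rightarrow> ('w \<Rightarrow> 'b::topological_space) \<Rightarrow> 'w measure" where
  "sigma_rv M X = vimage_algebra (space M) X borel"

definition cond_prob_on :: "'w measure \<Rightarrow> 'w measure \<Rightarrow> 'w set \<Rightarrow> 'w \<Rightarrow> real" where
  "cond_prob_on M F A = real_cond_exp M F (indicator A)"

(* Mutual (not merely pairwise) independence given F, in the shape of the library's indep_sets;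
   the versions of the conditional probabilities are identified almost everywhere. *)
definition cond_indep_rvs ::
  "'w measure \<Rightarrow> 'w measure \<Rightarrow> ('i \<Rightarrow> 'w \<Rightarrow> 'b::topological_space) \<Rightarrow> 'i set \<Rightarrow> bool" where
  "cond_indep_rvs M F Y I \<longleftrightarrow>
     (\<forall>i\<in>I. Y i \<in> borel_measurable M) \<and>
     (\<forall>J A. J \<subseteq> I \<longrightarrow> J \<noteq> {} \<longrightarrow> finite J \<longrightarrow> (\<forall>j\<in>J. A j \<in> sets borel) \<longrightarrow>
        (AE \<omega> in M. cond_prob_on M F (\<Inter>j\<in>J. Y j -` A j \<inter> space M) \<omega>
                  = (\<Prod>j\<in>J. cond_prob_on M F (Y j -` A j \<inter> space M) \<omega>)))"

(* real_cond_exp is only available for real-valued functions, so the vector identity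
   E[y | x] = x is stated for each component.  real_cond_exp is meaningful only for
   integrable arguments, whence the integrability clause. *)
definition cond_unbiased ::
  "'w measure \<Rightarrow> ('w \<Rightarrow> real^'d) \<Rightarrow> ('w \<Rightarrow> real^'d) \<Rightarrow> bool" where
  "cond_unbiased M x y \<longleftrightarrow>
     integrable M y \<and>
     (\<forall>k. AE \<omega> in M. real_cond_exp M (sigma_rv M x) (\<lambda>\<omega>. y \<omega> $ k) \<omega> = x \<omega> $ k)"

definition finite_second_moment :: "'w measure \<Rightarrow> ('w \<Rightarrow> real^'d) \<Rightarrow> bool" where
  "finite_second_moment M y \<longleftrightarrow>
     y \<in> borel_measurable M \<and> integrable M (\<lambda>\<omega>. (norm (y \<omega>))\<^sup>2)"

definition mse :: "'w measure \<Rightarrow> ('w \<Rightarrow> real^'d) \<Rightarrow> ('w \<Rightarrow> real^'d) \<Rightarrow> real^'d^'d" where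
  "mse M x y = (\<integral>\<omega>. columnvector (x \<omega> - y \<omega>) ** (rowvector (x \<omega> - y \<omega>) :: real^'d^1) \<partial>M)"

definition pos_def :: "real^'d^'d \<Rightarrow> bool" where
  "pos_def A \<longleftrightarrow> transpose A = A \<and> (\<forall>v. v \<noteq> 0 \<longrightarrow> v \<bullet> (A *v v) > 0)"

definition aa_fusion ::
  "nat \<Rightarrow> (nat \<Rightarrow> real) \<Rightarrow> (nat \<Rightarrow> 'w \<Rightarrow> real^'d) \<Rightarrow> 'w \<Rightarrow> real^'d" where
  "aa_fusion I w xhat = (\<lambda>\<omega>. \<Sum>i=1..I. w i *\<^sub>R xhat i \<omega>)"

(* The strict inequality is false without further assumptions: the difference equals
   sum_i w_i (1 - w_i) MSE_i, which is zero when one sensor carries the whole weight, and which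
   is singular when some nonzero linear functional of the state is estimated without error by
   every sensor of positive weight.  These are the only two exceptions, so the following
   condition is necessary as well as sufficient for strictness. *)
definition nondegenerate_fusion ::
  "'w measure \<Rightarrow> nat \<Rightarrow> (nat \<Rightarrow> real) \<Rightarrow> ('w \<Rightarrow> real^'d) \<Rightarrow> (nat \<Rightarrow> 'w \<Rightarrow> real^'d) \<Rightarrow> bool" where
  "nondegenerate_fusion M I w x xhat \<longleftrightarrow>
     (\<forall>i\<in>{1..I}. w i \<noteq> 1) \<and>
     (\<forall>v. v \<noteq> 0 \<longrightarrow> (\<exists>i\<in>{1..I}. w i > 0 \<and> \<not> (AE \<omega> in M. v \<bullet> (x \<omega> - xhat i \<omega>) = 0)))"

end

theory Submission
  imports Defs
begin

text \<open>
  For a fixed \<open>v\<close> put \<open>e\<^sub>i = v \<bullet> (x - xhat i)\<close> and \<open>e = (\<Sum>i. w i * e\<^sub>i)\<close>. The quadratic form at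
  \<open>v\<close> of the matrix in question is the expectation of \<open>(\<Sum>i. w i * (e\<^sub>i - e)\<^sup>2)\<close>, hence
  nonnegative. If it vanishes, the \<open>e\<^sub>i\<close> of all sensors of positive weight agree almost everywhere,
  and by nondegeneracy there are two such sensors. A random variable that agrees with a
  conditionally independent copy generates events whose conditional probabilities are idempotent,
  hence 0 or 1; so it is almost everywhere measurable with respect to the conditioning algebra and
  equals its own conditional expectation. By unbiasedness this makes every such \<open>e\<^sub>i\<close> vanish, which
  nondegeneracy excludes. No moment of a product of different sensors is needed.
\<close>

section \<open>Conditional zero-one law\<close>

context finite_measure_subalgebra
begin

text \<open>An idempotent real is 0 or 1, so the conditional probability \<open>p\<close> of
  \<open>A\<close> is almost everywhere the indicator of \<open>B = {p = 1}\<close>, a set of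
  \<open>F\<close>. Integrating \<open>p\<close> over the space and over \<open>B\<close> then shows
  that \<open>A\<close>, \<open>B\<close> and their intersection have the same mass.\<close>

lemma idempotent_cond_prob_event:
  assumes A [measurable]: "A \<in> sets M"
    and idem: "AE x in M. real_cond_exp M F (indicator A) x = (real_cond_exp M F (indicator A) x)\<^sup>2"
  obtains B where "B \<in> sets F" "AE x in M. x \<in> A \<longleftrightarrow> x \<in> B"
proof -
  define p where "p = real_cond_exp M F (indicator A)"
  define B where "B = {x \<in> space F. p x = 1}"
  have [measurable]: "p \<in> borel_measurable F"
    unfolding p_def by simp
  have B [measurable]: "B \<in> sets F"
    unfolding B_def by measurable
  have BM [measurable]: "B \<in> sets M"
    using B subalg by (auto simp: subalgebra_def)
  have [measurable]: "p \<in> borel_measurable M"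
    unfolding p_def by simp
  have iA: "integrable M (indicator A :: _ \<Rightarrow> real)" and iB: "integrable M (indicator B :: _ \<Rightarrow> real)"
    by (simp_all add: emeasure_finite less_top[symmetric])
  have iBA: "integrable M (\<lambda>x. indicator B x * indicator A x :: real)"
    using integrable_mult_indicator[OF BM iA] by simp
  have pB: "AE x in M. p x = indicator B x"
    using idem AE_space
  proof eventually_elim
    case (elim x)
    then have "p x = 0 \<or> p x = 1"
      by (auto simp: p_def power2_eq_square)
    then show ?case
      using elim subalg by (auto simp: B_def subalgebra_def indicator_def)
  qed
  have 1: "(\<integral>x. indicator A x \<partial>M) = (\<integral>x. indicator B x \<partial>M :: real)"
  proof -
    have "(\<integral>x. indicator A x \<partial>M) = (\<integral>x. p x \<partial>M)"
      unfolding p_def using real_cond_exp_int(2)[OF iA] by simp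
    also have "\<dots> = (\<integral>x. indicator B x \<partial>M)"
      using pB by (intro integral_cong_AE) auto
    finally show ?thesis .
  qed
  have 2: "(\<integral>x. indicator B x * indicator A x \<partial>M) = (\<integral>x. indicator B x \<partial>M :: real)"
  proof -
    have "(\<integral>x. indicator B x * indicator A x \<partial>M) = (\<integral>x. indicator B x * p x \<partial>M)"
      unfolding p_def by (rule real_cond_exp_intg(2)[symmetric]) (use iBA in auto)
    also have "\<dots> = (\<integral>x. indicator B x \<partial>M)"
      using pB by (intro integral_cong_AE) (auto simp: indicator_def)
    finally show ?thesis .
  qed
  \<comment> \<open>This squared difference integrates to the mass of the symmetric difference of
    \<open>A\<close> and \<open>B\<close>, which is 0 by facts \<open>1\<close> and
    \<open>2\<close>.\<close>
  have eq: "(indicator A x - indicator B x)\<^sup>2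
      = indicator A x + indicator B x - 2 * (indicator B x * indicator A x :: real)" for x
    by (auto simp: indicator_def)
  have int: "integrable M (\<lambda>x. (indicator A x - indicator B x :: real)\<^sup>2)"
    unfolding eq using iA iB iBA 
    by (intro Bochner_Integration.integrable_diff Bochner_Integration.integrable_add integrable_mult_right)
  have "(\<integral>x. (indicator A x - indicator B x)\<^sup>2 \<partial>M) = (0::real)"
    unfolding eq using iA iB iBA 1 2 by simp
  then have "AE x in M. (indicator A x - indicator B x :: real)\<^sup>2 = 0"
    using integral_nonneg_eq_0_iff_AE[OF int] by simp
  then have "AE x in M. x \<in> A \<longleftrightarrow> x \<in> B"
    by eventually_elim (auto simp: indicator_def split: if_splits)
  with B show thesis by (rule that)
qed

text \<open>Since \<open>D\<close> lies in \<open>F\<close>, the integral of \<open>U\<close> over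
  \<open>D\<close> does not change when \<open>U\<close> is replaced by its conditional expectation,
  hence it is 0. A function that is positive on \<open>D\<close> can have integral 0 there only if
  \<open>D\<close> is null.\<close>

lemma centered_positive_imp_null:
  assumes U: "integrable M U" and centered: "AE x in M. real_cond_exp M F U x = 0"
    and D [measurable]: "D \<in> sets F" and pos: "AE x in M. x \<in> D \<longrightarrow> U x > 0"
  shows "AE x in M. x \<notin> D"
proof -
  have DM: "D \<in> sets M"
    using D subalg by (auto simp: subalgebra_def)
  have int: "integrable M (\<lambda>x. indicator D x * U x)"
    using integrable_mult_indicator[OF DM U] by simp
  have "(\<integral>x. indicator D x * U x \<partial>M) = (\<integral>x. indicator D x * real_cond_exp M F U x \<partial>M)"
    using int U by (intro real_cond_exp_intg(2)[symmetric]) auto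
  also have "\<dots> = 0"
    using centered by (intro integral_eq_zero_AE) auto
  finally have "AE x in M. indicator D x * U x = 0"
    using pos by (subst (asm) integral_nonneg_eq_0_iff_AE[OF int])
      (auto simp: indicator_def less_imp_le elim!: eventually_mono)
  with pos show ?thesis
    by eventually_elim (auto simp: indicator_def)
qed

text \<open>Wherever \<open>X\<close> and \<open>Z\<close> differ, a rational \<open>q\<close> lies
  strictly between them. The event that \<open>X\<close> is on one side of \<open>q\<close> can be
  exchanged for a set of \<open>F\<close>, and on its intersection with the event that
  \<open>Z\<close> is on the other side the centered variable \<open>Z - X\<close> or
  \<open>X - Z\<close> is positive.\<close>

lemma eq_cond_exp_if_events_AE_measurable:
  assumes X: "integrable M X" and Z [measurable]: "Z \<in> borel_measurable F"
    and cond: "AE x in M. real_cond_exp M F X x = Z x"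
    and ev: "\<And>S. S \<in> sets borel \<Longrightarrow> \<exists>B\<in>sets F. AE x in M. X x \<in> S \<longleftrightarrow> x \<in> B"
  shows "AE x in M. X x = Z x"
proof -
  have ZM [measurable]: "Z \<in> borel_measurable M"
    by (rule measurable_from_subalg[OF subalg Z])
  have iZ: "integrable M Z"
    using Bochner_Integration.integrable_cong_AE[THEN iffD1, OF _ _ cond real_cond_exp_int(1)[OF X]] by simp
  have ZZ: "AE x in M. real_cond_exp M F Z x = Z x"
    using iZ Z by (rule real_cond_exp_F_meas)
  have c1: "AE x in M. real_cond_exp M F (\<lambda>x. Z x - X x) x = 0"
    using real_cond_exp_diff[OF iZ X] ZZ cond by eventually_elim simp
  have c2: "AE x in M. real_cond_exp M F (\<lambda>x. X x - Z x) x = 0"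
    using real_cond_exp_diff[OF X iZ] ZZ cond by eventually_elim simp
  have 1: "AE x in M. \<not> (X x < q \<and> q < Z x)" for q
  proof -
    obtain B where [measurable]: "B \<in> sets F" and B: "AE x in M. X x \<in> {..<q} \<longleftrightarrow> x \<in> B"
      using ev[of "{..<q}"] by auto
    have "AE x in M. x \<notin> B \<inter> {x \<in> space F. q < Z x}"
    proof (rule centered_positive_imp_null[OF _ c1])
      show "AE x in M. x \<in> B \<inter> {x \<in> space F. q < Z x} \<longrightarrow> Z x - X x > 0"
        using B by eventually_elim auto
    qed (use iZ X in auto)
    with B AE_space show ?thesis
      by eventually_elim (use subalg in \<open>auto simp: subalgebra_def\<close>)
  qed
  have 2: "AE x in M. \<not> (Z x < q \<and> q < X x)" for q
  proof -
    obtain B where [measurable]: "B \<in> sets F" and B: "AE x in M. X x \<in> {q<..} \<longleftrightarrow> x \<in> B"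
      using ev[of "{q<..}"] by auto
    have "AE x in M. x \<notin> B \<inter> {x \<in> space F. Z x < q}"
    proof (rule centered_positive_imp_null[OF _ c2])
      show "AE x in M. x \<in> B \<inter> {x \<in> space F. Z x < q} \<longrightarrow> X x - Z x > 0"
        using B by eventually_elim auto
    qed (use iZ X in auto)
    with B AE_space show ?thesis
      by eventually_elim (use subalg in \<open>auto simp: subalgebra_def\<close>)
  qed
  \<comment> \<open>Restricting \<open>q\<close> to the rationals keeps the union of the exceptional
    null sets countable.\<close>
  have "AE x in M. \<forall>q::rat. \<not> (X x < of_rat q \<and> of_rat q < Z x) \<and> \<not> (Z x < of_rat q \<and> of_rat q < X x)"
    using 1 2 by (subst AE_all_countable) auto
  then show ?thesis
  proof eventually_elim
    case (elim x)
    then show ?case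
      using of_rat_dense[of "X x" "Z x"] of_rat_dense[of "Z x" "X x"] by (meson linorder_neqE)
  qed
qed

end

text \<open>The events that \<open>Y i\<close> and \<open>Y j\<close> fall in \<open>A\<close>
  coincide up to a null set, so their intersection has the conditional probability of either one. By
  conditional independence it also has the square of it, and the zero-one law applies.\<close>

lemma cond_indep_copies_AE_measurable:
  fixes Y :: "'i \<Rightarrow> 'w \<Rightarrow> 'b::topological_space"
  assumes fms: "finite_measure_subalgebra M F"
    and indep: "cond_indep_rvs M F Y I" and ij: "i \<in> I" "j \<in> I" "i \<noteq> j"
    and A: "A \<in> sets borel" and copies: "AE \<omega> in M. Y i \<omega> \<in> A \<longleftrightarrow> Y j \<omega> \<in> A"
  shows "\<exists>B\<in>sets F. AE \<omega> in M. Y i \<omega> \<in> A \<longleftrightarrow> \<omega> \<in> B"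
proof -
  interpret finite_measure_subalgebra M F by fact
  have [measurable]: "Y i \<in> borel_measurable M" "Y j \<in> borel_measurable M"
    using indep ij by (auto simp: cond_indep_rvs_def)
  note [measurable] = A
  let ?E = "\<lambda>k. Y k -` A \<inter> space M"
  have E [measurable]: "?E i \<in> sets M" "?E j \<in> sets M"
    by measurable
  have "\<forall>J A. J \<subseteq> I \<longrightarrow> J \<noteq> {} \<longrightarrow> finite J \<longrightarrow> (\<forall>j\<in>J. A j \<in> sets borel) \<longrightarrow>
        (AE \<omega> in M. cond_prob_on M F (\<Inter>j\<in>J. Y j -` A j \<inter> space M) \<omega>
                  = (\<Prod>j\<in>J. cond_prob_on M F (Y j -` A j \<inter> space M) \<omega>))"
    using indep by (simp add: cond_indep_rvs_def)
  \<comment> \<open>As \<open>i\<close> and \<open>j\<close> differ, the product over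
    \<open>{i, j}\<close> has two factors.\<close>
  from this[rule_format, of "{i, j}" "\<lambda>_. A"]
  have prod: "AE \<omega> in M. real_cond_exp M F (indicator (?E i \<inter> ?E j)) \<omega>
      = real_cond_exp M F (indicator (?E i)) \<omega> * real_cond_exp M F (indicator (?E j)) \<omega>"
    using ij A by (simp add: cond_prob_on_def)
  have j: "AE \<omega> in M. real_cond_exp M F (indicator (?E j)) \<omega> = real_cond_exp M F (indicator (?E i)) \<omega>"
    using copies by (intro real_cond_exp_cong) (auto simp: indicator_def elim!: eventually_mono)
  have inter: "AE \<omega> in M. real_cond_exp M F (indicator (?E i \<inter> ?E j)) \<omega>
      = real_cond_exp M F (indicator (?E i)) \<omega>"
    using copies by (intro real_cond_exp_cong) (auto simp: indicator_def elim!: eventually_mono)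
  have "AE \<omega> in M. real_cond_exp M F (indicator (?E i)) \<omega> = (real_cond_exp M F (indicator (?E i)) \<omega>)\<^sup>2"
    using prod j inter by eventually_elim (simp add: power2_eq_square)
  then obtain B where "B \<in> sets F" and B: "AE \<omega> in M. \<omega> \<in> ?E i \<longleftrightarrow> \<omega> \<in> B"
    using idempotent_cond_prob_event[OF E(1)] by blast
  moreover have "AE \<omega> in M. Y i \<omega> \<in> A \<longleftrightarrow> \<omega> \<in> B"
    using B AE_space by eventually_elim auto
  ultimately show ?thesis by blast
qed

section \<open>Conditioning on the state\<close>

lemma subalgebra_sigma_rv: "X \<in> borel_measurable M \<Longrightarrow> subalgebra M (sigma_rv M X)"
  by (auto simp: subalgebra_def sigma_rv_def sets_vimage_algebra2 intro: measurable_sets)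

lemma measurable_sigma_rv: "X \<in> borel_measurable (sigma_rv M X)"
  unfolding sigma_rv_def by (rule measurable_vimage_algebra1) simp

lemma cond_unbiased_inner:
  fixes x y :: "'w \<Rightarrow> real^'d"
  assumes fms: "finite_measure_subalgebra M (sigma_rv M x)" and y: "cond_unbiased M x y"
  shows "AE \<omega> in M. real_cond_exp M (sigma_rv M x) (\<lambda>\<omega>. v \<bullet> y \<omega>) \<omega> = v \<bullet> x \<omega>"
proof -
  interpret finite_measure_subalgebra M "sigma_rv M x" by fact
  let ?E = "real_cond_exp M (sigma_rv M x)"
  have iy: "integrable M (\<lambda>\<omega>. y \<omega> $ k)" for k
    using y integrable_bounded_linear[OF bounded_linear_vec_nth] by (auto simp: cond_unbiased_def)
  \<comment> \<open>Unbiasedness is given per component; the coordinate expansion of the inner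
    product carries it over to the functional \<open>v\<close>.\<close>
  have 1: "AE \<omega> in M. ?E (\<lambda>\<omega>. \<Sum>k\<in>UNIV. v $ k * y \<omega> $ k) \<omega> = (\<Sum>k\<in>UNIV. ?E (\<lambda>\<omega>. v $ k * y \<omega> $ k) \<omega>)"
    using iy by (intro real_cond_exp_sum) auto
  have 2: "AE \<omega> in M. \<forall>k. ?E (\<lambda>\<omega>. v $ k * y \<omega> $ k) \<omega> = v $ k * ?E (\<lambda>\<omega>. y \<omega> $ k) \<omega>"
    using iy by (subst AE_all_countable) (auto intro: real_cond_exp_cmult)
  have 3: "AE \<omega> in M. \<forall>k. ?E (\<lambda>\<omega>. y \<omega> $ k) \<omega> = x \<omega> $ k"
    using y by (subst AE_all_countable) (auto simp: cond_unbiased_def)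
  show ?thesis
    using 1 2 3 by eventually_elim (simp add: inner_vec_def)
qed

lemma equal_sensors_exact:
  fixes x :: "'w \<Rightarrow> real^'d"
  assumes "prob_space M" and x: "x \<in> borel_measurable M"
    and indep: "cond_indep_rvs M (sigma_rv M x) y I" and ij: "i \<in> I" "j \<in> I" "i \<noteq> j"
    and unb: "cond_unbiased M x (y i)"
    and eq: "AE \<omega> in M. v \<bullet> y i \<omega> = v \<bullet> y j \<omega>"
  shows "AE \<omega> in M. v \<bullet> y i \<omega> = v \<bullet> x \<omega>"
proof -
  interpret prob_space M by fact
  have fms: "finite_measure_subalgebra M (sigma_rv M x)"
    using subalgebra_sigma_rv[OF x] by unfold_locales
  show ?thesis
  proof (rule finite_measure_subalgebra.eq_cond_exp_if_events_AE_measurable[OF fms])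
    show "integrable M (\<lambda>\<omega>. v \<bullet> y i \<omega>)"
      using unb by (auto simp: cond_unbiased_def)
    show "(\<lambda>\<omega>. v \<bullet> x \<omega>) \<in> borel_measurable (sigma_rv M x)"
      using measurable_sigma_rv[of x M] by measurable
    show "AE \<omega> in M. real_cond_exp M (sigma_rv M x) (\<lambda>\<omega>. v \<bullet> y i \<omega>) \<omega> = v \<bullet> x \<omega>"
      by (rule cond_unbiased_inner[OF fms unb])
    fix S :: "real set" assume [measurable]: "S \<in> sets borel"
    \<comment> \<open>Independence concerns the whole vectors, while only their values under
      \<open>v\<close> agree. Preimages of scalar Borel sets under \<open>v\<close> are Borel sets
      of vectors that do not distinguish the two sensors.\<close>
    have "{u. v \<bullet> u \<in> S} \<in> sets borel"
      by measurable
    moreover have "AE \<omega> in M. y i \<omega> \<in> {u. v \<bullet> u \<in> S} \<longleftrightarrow> y j \<omega> \<in> {u. v \<bullet> u \<in> S}"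
      using eq by eventually_elim simp
    ultimately have "\<exists>B\<in>sets (sigma_rv M x). AE \<omega> in M. y i \<omega> \<in> {u. v \<bullet> u \<in> S} \<longleftrightarrow> \<omega> \<in> B"
      by (rule cond_indep_copies_AE_measurable[OF fms indep ij])
    then show "\<exists>B\<in>sets (sigma_rv M x). AE \<omega> in M. v \<bullet> y i \<omega> \<in> S \<longleftrightarrow> \<omega> \<in> B"
      by simp
  qed
qed

section \<open>Second moments and the mean square error matrix\<close>

lemma finite_second_moment_add:
  fixes y z :: "'w \<Rightarrow> real^'d"
  assumes "finite_second_moment M y" "finite_second_moment M z"
  shows "finite_second_moment M (\<lambda>\<omega>. y \<omega> + z \<omega>)"
proof -
  have [measurable]: "y \<in> borel_measurable M" "z \<in> borel_measurable M"
    using assms by (auto simp: finite_second_moment_def)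
  have bound: "(norm (a + b))\<^sup>2 \<le> 2 * (norm a)\<^sup>2 + 2 * (norm b)\<^sup>2" for a b :: "real^'d"
    using power_mono[OF norm_triangle_ineq[of a b], of 2] sum_squares_bound[of "norm a" "norm b"]
    by (simp add: power2_sum)
  have "integrable M (\<lambda>\<omega>. (norm (y \<omega> + z \<omega>))\<^sup>2)"
  proof (rule Bochner_Integration.integrable_bound)
    show "integrable M (\<lambda>\<omega>. 2 * (norm (y \<omega>))\<^sup>2 + 2 * (norm (z \<omega>))\<^sup>2)"
      using assms by (auto simp: finite_second_moment_def)
  qed (use bound in auto)
  then show ?thesis
    by (simp add: finite_second_moment_def)
qed

lemma finite_second_moment_scaleR:
  "finite_second_moment M y \<Longrightarrow> finite_second_moment M (\<lambda>\<omega>. c *\<^sub>R y \<omega>)"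
  by (auto simp: finite_second_moment_def power_mult_distrib)

lemma finite_second_moment_diff:
  assumes "finite_second_moment M y" "finite_second_moment M z"
  shows "finite_second_moment M (\<lambda>\<omega>. y \<omega> - z \<omega>)"
  using finite_second_moment_add[OF assms(1) finite_second_moment_scaleR[OF assms(2), of "-1"]] by simp

lemma finite_second_moment_sum:
  assumes "\<And>i. i \<in> S \<Longrightarrow> finite_second_moment M (y i)"
  shows "finite_second_moment M (\<lambda>\<omega>. \<Sum>i\<in>S. y i \<omega>)"
  \<comment> \<open>For infinite \<open>S\<close> the sum is 0 by convention, so this case reduces,
    like the empty one, to the zero variable.\<close>
  using assms
  by (induction S rule: infinite_finite_induct)
    (auto intro: finite_second_moment_add simp: finite_second_moment_def[of M "\<lambda>_. 0"])

lemma finite_second_moment_inner_square: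
  assumes "finite_second_moment M y"
  shows "integrable M (\<lambda>\<omega>. (v \<bullet> y \<omega>)\<^sup>2)"
proof (rule Bochner_Integration.integrable_bound)
  show "integrable M (\<lambda>\<omega>. (norm v)\<^sup>2 * (norm (y \<omega>))\<^sup>2)"
    using assms by (auto simp: finite_second_moment_def)
  show "(\<lambda>\<omega>. (v \<bullet> y \<omega>)\<^sup>2) \<in> borel_measurable M"
    using assms by (auto simp: finite_second_moment_def)
  show "AE \<omega> in M. norm ((v \<bullet> y \<omega>)\<^sup>2) \<le> norm ((norm v)\<^sup>2 * (norm (y \<omega>))\<^sup>2)"
    using power_mono[OF Cauchy_Schwarz_ineq2, of v _ 2] by (simp add: power_mult_distrib)
qed

section \<open>Outer products and quadratic forms of the MSE matrix\<close>

abbreviation outer :: "real^'d \<Rightarrow> real^'d \<Rightarrow> real^'d^'d" where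
  "outer a b \<equiv> columnvector a ** (rowvector b :: real^'d^1)"

text \<open>In finite dimension bilinearity implies boundedness, so linearity in each argument
  suffices. Boundedness yields the continuity and the norm estimate behind the integrability of the
  outer product.\<close>

lemma bounded_bilinear_outer: "bounded_bilinear (outer :: real^'d \<Rightarrow> _)"
  unfolding bilinear_conv_bounded_bilinear[symmetric] bilinear_def
  by (auto intro!: linearI
      simp: vec_eq_iff matrix_matrix_mult_def columnvector_def rowvector_def algebra_simps)

lemma integrable_outer:
  fixes y :: "'w \<Rightarrow> real^'d"
  assumes "finite_second_moment M y"
  shows "integrable M (\<lambda>\<omega>. outer (y \<omega>) (y \<omega>))"
proof -
  interpret bounded_bilinear "outer :: real^'d \<Rightarrow> _" by (rule bounded_bilinear_outer)
  obtain K where K: "\<And>a b :: real^'d. norm (outer a b) \<le> norm a * norm b * K"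
    using bounded by blast
  have y: "y \<in> borel_measurable M" "integrable M (\<lambda>\<omega>. (norm (y \<omega>))\<^sup>2)"
    using assms by (auto simp: finite_second_moment_def)
  show ?thesis
  proof (rule Bochner_Integration.integrable_bound)
    show "integrable M (\<lambda>\<omega>. (norm (y \<omega>))\<^sup>2 * K)"
      using y by auto
    have "continuous_on UNIV (\<lambda>a :: real^'d. outer a a)"
      by (intro continuous_on continuous_on_id)
    then have "(\<lambda>a :: real^'d. outer a a) \<in> borel_measurable borel"
      by (rule borel_measurable_continuous_onI)
    then show "(\<lambda>\<omega>. outer (y \<omega>) (y \<omega>)) \<in> borel_measurable M"
      by (rule measurable_compose[OF y(1)])
    show "AE \<omega> in M. norm (outer (y \<omega>) (y \<omega>)) \<le> norm ((norm (y \<omega>))\<^sup>2 * K)"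
      \<comment> \<open>The sign of \<open>K\<close> is unknown, so the bound passes through the
        absolute value.\<close>
      using K by (auto simp: power2_eq_square intro: order_trans[OF _ abs_ge_self])
  qed
qed

text \<open>For fixed \<open>v\<close> the quadratic form is linear in the matrix, so it commutes
  with the Bochner integral that defines \<open>mse\<close>.\<close>

lemma bounded_linear_quadratic_form:
  "bounded_linear (\<lambda>A :: real^'d^'d. v \<bullet> (A *v v))"
  unfolding linear_conv_bounded_linear[symmetric]
  by (auto intro!: linearI
      simp: matrix_vector_mult_add_rdistrib inner_add_right scaleR_matrix_vector_assoc[symmetric])

lemma quadratic_form_outer: "v \<bullet> (outer a a *v v) = (v \<bullet> a)\<^sup>2"
  by (simp add: inner_vec_def matrix_vector_mult_def matrix_matrix_mult_def columnvector_def
      rowvector_def power2_eq_square sum_product sum_distrib_left mult_ac)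

lemma quadratic_form_mse:
  assumes "finite_second_moment M x" "finite_second_moment M y"
  shows "v \<bullet> (mse M x y *v v) = (\<integral>\<omega>. (v \<bullet> (x \<omega> - y \<omega>))\<^sup>2 \<partial>M)"
  unfolding mse_def
  using integral_bounded_linear[OF bounded_linear_quadratic_form
      integrable_outer[OF finite_second_moment_diff[OF assms]], of v]
  by (simp add: quadratic_form_outer)

lemma transpose_mse:
  fixes x y :: "'w \<Rightarrow> real^'d"
  assumes "finite_second_moment M x" "finite_second_moment M y"
  shows "transpose (mse M x y) = mse M x y"
proof -
  have "bounded_linear (transpose :: real^'d^'d \<Rightarrow> _)"
    unfolding linear_conv_bounded_linear[symmetric]
    by (auto intro!: linearI simp: transpose_def vec_eq_iff)
  from integral_bounded_linear[OF this integrable_outer[OF finite_second_moment_diff[OF assms]]]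
  show ?thesis
    by (simp add: mse_def matrix_transpose_mul transpose_rowvector transpose_columnvector)
qed

section \<open>Weighted variance and strict positivity\<close>

lemma weighted_variance_eq:
  fixes w e :: "'i \<Rightarrow> real"
  assumes "(\<Sum>i\<in>S. w i) = 1"
  shows "(\<Sum>i\<in>S. w i * (e i - (\<Sum>j\<in>S. w j * e j))\<^sup>2)
    = (\<Sum>i\<in>S. w i * ((e i)\<^sup>2 - (\<Sum>j\<in>S. w j * e j)\<^sup>2))"
proof -
  define m where "m = (\<Sum>j\<in>S. w j * e j)"
  \<comment> \<open>After summation the last two terms become \<open>2 * m\<^sup>2\<close> and
    \<open>- 2 * m * m\<close>, which cancel.\<close>
  have "w i * (e i - m)\<^sup>2 = w i * ((e i)\<^sup>2 - m\<^sup>2) + 2 * m\<^sup>2 * w i - 2 * m * (w i * e i)" for i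
    by (simp add: power2_diff power2_eq_square algebra_simps)
  then have "(\<Sum>i\<in>S. w i * (e i - m)\<^sup>2)
      = (\<Sum>i\<in>S. w i * ((e i)\<^sup>2 - m\<^sup>2)) + 2 * m\<^sup>2 * (\<Sum>i\<in>S. w i) - 2 * m * m"
    by (simp add: sum.distrib sum_subtractf sum_distrib_left m_def)
  then show ?thesis
    using assms by (simp add: m_def power2_eq_square)
qed

theorem lemma4:
  fixes M :: "'w measure"
    and x :: "'w \<Rightarrow> real^'d"
    and xhat :: "nat \<Rightarrow> 'w \<Rightarrow> real^'d"
    and w :: "nat \<Rightarrow> real"
    and I :: nat
  assumes "prob_space M"
    and "finite_second_moment M x"
    and "\<And>i. i \<in> {1..I} \<Longrightarrow> finite_second_moment M (xhat i)"
    and "cond_indep_rvs M (sigma_rv M x) xhat {1..I}"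
    and "\<And>i. i \<in> {1..I} \<Longrightarrow> cond_unbiased M x (xhat i)"
    and "\<And>i. i \<in> {1..I} \<Longrightarrow> w i \<ge> 0"
    and "(\<Sum>i=1..I. w i) = 1"
    and "nondegenerate_fusion M I w x xhat"
  shows "pos_def (\<Sum>i=1..I. w i *\<^sub>R (mse M x (xhat i) - mse M x (aa_fusion I w xhat)))"
    (is "pos_def ?D")
proof -
  have AA: "finite_second_moment M (aa_fusion I w xhat)"
    unfolding aa_fusion_def
    using assms(3) by (intro finite_second_moment_sum finite_second_moment_scaleR)
  have "?D $ a $ b = ?D $ b $ a" for a b
    using transpose_mse[OF assms(2,3)] transpose_mse[OF assms(2) AA]
    by (simp add: transpose_def vec_eq_iff)
  then have sym: "transpose ?D = ?D"
    by (simp add: transpose_def vec_eq_iff)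
  have "v \<bullet> (?D *v v) > 0" if v: "v \<noteq> 0" for v
  proof (rule ccontr)
    assume not_pos: "\<not> v \<bullet> (?D *v v) > 0"
    interpret q: bounded_linear "\<lambda>A :: real^'d^'d. v \<bullet> (A *v v)"
      by (rule bounded_linear_quadratic_form)
    define e where "e i \<omega> = v \<bullet> (x \<omega> - xhat i \<omega>)" for i \<omega>
    define m where "m \<omega> = (\<Sum>j=1..I. w j * e j \<omega>)" for \<omega>
    define V where "V \<omega> = (\<Sum>i=1..I. w i * (e i \<omega> - m \<omega>)\<^sup>2)" for \<omega>
    \<comment> \<open>Because the weights sum to 1, \<open>x\<close> can be moved inside the
      weighted sum: the error of the fusion is the weighted mean of the sensor errors.\<close>
    have m: "v \<bullet> (x \<omega> - aa_fusion I w xhat \<omega>) = m \<omega>" for \<omega>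
      using assms(7)
      by (simp add: m_def e_def aa_fusion_def inner_diff_right inner_sum_right sum_subtractf
          right_diff_distrib flip: sum_distrib_right)
    have e2: "integrable M (\<lambda>\<omega>. (e i \<omega>)\<^sup>2)" if "i \<in> {1..I}" for i
      unfolding e_def
      using that assms(2,3) by (intro finite_second_moment_inner_square finite_second_moment_diff)
    have m2: "integrable M (\<lambda>\<omega>. (m \<omega>)\<^sup>2)"
      unfolding m[symmetric]
      using assms(2) AA by (intro finite_second_moment_inner_square finite_second_moment_diff)
    have V_eq: "V \<omega> = (\<Sum>i=1..I. w i * ((e i \<omega>)\<^sup>2 - (m \<omega>)\<^sup>2))" for \<omega>
      unfolding V_def m_def by (rule weighted_variance_eq[OF assms(7)])
    have iV: "integrable M V"
      unfolding V_eq using e2 m2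
      by (intro Bochner_Integration.integrable_sum integrable_mult_right Bochner_Integration.integrable_diff)
    have V_nonneg: "V \<omega> \<ge> 0" for \<omega>
      unfolding V_def using assms(6) by (intro sum_nonneg) auto
    have "v \<bullet> (?D *v v) = (\<Sum>i=1..I. w i * ((\<integral>\<omega>. (e i \<omega>)\<^sup>2 \<partial>M) - (\<integral>\<omega>. (m \<omega>)\<^sup>2 \<partial>M)))"
      unfolding q.sum q.scaleR q.diff quadratic_form_mse[OF assms(2) AA] m
      using assms(2,3) by (intro sum.cong) (simp_all add: quadratic_form_mse e_def)
    also have "\<dots> = (\<integral>\<omega>. V \<omega> \<partial>M)"
      unfolding V_eq using e2 m2 by (subst Bochner_Integration.integral_sum) auto
    finally have "v \<bullet> (?D *v v) = (\<integral>\<omega>. V \<omega> \<partial>M)" .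
    moreover have "(\<integral>\<omega>. V \<omega> \<partial>M) \<ge> 0"
      using V_nonneg by (rule Bochner_Integration.integral_nonneg)
    ultimately have "(\<integral>\<omega>. V \<omega> \<partial>M) = 0"
      using not_pos by linarith
    then have V0: "AE \<omega> in M. V \<omega> = 0"
      using integral_nonneg_eq_0_iff_AE[OF iV] V_nonneg by simp
    \<comment> \<open>A vanishing sum of nonnegative terms vanishes termwise, and a positive weight
      can be cancelled.\<close>
    have same: "AE \<omega> in M. e i \<omega> = m \<omega>" if i: "i \<in> {1..I}" "w i > 0" for i
      using V0
    proof eventually_elim
      case (elim \<omega>)
      then have "\<forall>k\<in>{1..I}. w k * (e k \<omega> - m \<omega>)\<^sup>2 = 0"
        unfolding V_def using assms(6) by (subst (asm) sum_nonneg_eq_0_iff) auto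
      then have "w i * (e i \<omega> - m \<omega>)\<^sup>2 = 0"
        using i(1) by blast
      then show ?case using i by simp
    qed
    obtain i where i: "i \<in> {1..I}" "w i > 0" and inexact: "\<not> (AE \<omega> in M. e i \<omega> = 0)"
      using assms(8) v unfolding nondegenerate_fusion_def e_def by blast
    \<comment> \<open>If all other weights were 0, sensor \<open>i\<close> would carry weight 1,
      which \<open>nondegenerate_fusion\<close> forbids.\<close>
    have "\<exists>j\<in>{1..I} - {i}. w j \<noteq> 0"
    proof (rule ccontr)
      assume "\<not> ?thesis"
      then have "(\<Sum>j\<in>{1..I} - {i}. w j) = 0" by simp
      then have "w i = 1"
        using assms(7) sum.remove[of "{1..I}" i w] i by simp
      with i assms(8) show False by (auto simp: nondegenerate_fusion_def)
    qed
    then obtain j where j: "j \<in> {1..I}" "w j > 0" "i \<noteq> j"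
      using assms(6) by (metis Diff_iff insertI1 order_le_less)
    \<comment> \<open>Both errors equal \<open>m\<close>, and the common term
      \<open>v \<bullet> x \<omega>\<close> drops out, so \<open>equal_sensors_exact\<close> makes
      sensor \<open>i\<close> exact in direction \<open>v\<close>, against its choice.\<close>
    have "AE \<omega> in M. v \<bullet> xhat i \<omega> = v \<bullet> xhat j \<omega>"
      using same[OF i] same[OF j(1,2)] by eventually_elim (simp add: e_def inner_diff_right)
    then have "AE \<omega> in M. v \<bullet> xhat i \<omega> = v \<bullet> x \<omega>"
      using assms(2) i j
      by (intro equal_sensors_exact[OF assms(1) _ assms(4) _ _ _ assms(5)])
        (auto simp: finite_second_moment_def)
    then have "AE \<omega> in M. e i \<omega> = 0"
      by eventually_elim (simp add: e_def inner_diff_right)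
    with inexact show False by simp
  qed
  with sym show ?thesis by (simp add: pos_def_def)
qed

end
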